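(* Let $R$ be a commutative ring with unity, let $Y\subseteq \mathrm{Spec}(R)$ with $k(Y)=\mathrm{Rad}(R)$, and let $I$ be an ideal of $R$. Then: (a) The following three statements are equivalent: (i) $I$ is a $z^\circ$-ideal; (ii) for all $b\in I$ and $a\in R$, $(h_Y(b))^\circ\subseteq h_Y(a)$ implies $a\in I$; (iii) for all $b\in I$ and $S\subseteq R$, $(h_Y(b))^\circ\subseteq h_Y(S)$ implies $S\subseteq I$. (b) The following three statements are equivalent: (i) $I$ is an $sz^\circ$-ideal; (ii) for every finite subset $F$ of $I$ and every $a\in R$, $(h_Y(F))^\circ\subseteq h_Y(a)$ implies $a\in I$; (iii) for every finite subset $F$ of $I$ and every $S\subseteq R$, $(h_Y(F))^\circ\subseteq h_Y(S)$ implies $S\subseteq I$.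
   Context: For $Z\subseteq\mathrm{Spec}(R)$ and $S\subseteq R$, $h_Z(S)=\{P\in Z: S\subseteq P\}$, $h_Z(a)=h_Z(\{a\})$, and $k(Z)=\bigcap_{P\in Z}P$ (with $k(\emptyset)=R$). $\mathrm{Rad}(R)$ is the intersection of all prime ideals of $R$. $Y$ carries the Zariski topology, whose closed sets are the sets $h_Y(J)$, $J$ an ideal of $R$; $A^\circ$ denotes the interior in $Y$ of $A\subseteq Y$. Let $\mathrm{Min}(R)$ be the set of minimal prime ideals of $R$ and write $h_m=h_{\mathrm{Min}(R)}$. An ideal $I$ is a $z^\circ$-ideal if $b\in I$, $a\in R$ and $h_m(b)\subseteq h_m(a)$ imply $a\in I$; it is an $sz^\circ$-ideal if for every finite $F\subseteq I$ and $a\in R$, $h_m(F)\subseteq h_m(a)$ implies $a\in I$. *)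

theory Defs
  imports "HOL-Analysis.Abstract_Topology" "HOL-Algebra.Ideal"
begin

definition Spec :: "('a, 'b) ring_scheme \<Rightarrow> 'a set set" where
  "Spec R = {P. primeideal P R}"

definition Min_primes :: "('a, 'b) ring_scheme \<Rightarrow> 'a set set" where
  "Min_primes R = {P \<in> Spec R. \<forall>Q \<in> Spec R. Q \<subseteq> P \<longrightarrow> Q = P}"

text \<open>The hull and kernel operators. The kernel is intersected with the carrier, so that the
  kernel of the empty family is the whole ring rather than the universe of the type.\<close>

definition hull_in :: "'a set set \<Rightarrow> 'a set \<Rightarrow> 'a set set" where
  "hull_in Z S = {P \<in> Z. S \<subseteq> P}"

definition ker_of :: "('a, 'b) ring_scheme \<Rightarrow> 'a set set \<Rightarrow> 'a set" where
  "ker_of R Z = carrier R \<inter> \<Inter> Z"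

definition Rad :: "('a, 'b) ring_scheme \<Rightarrow> 'a set" where
  "Rad R = ker_of R (Spec R)"

text \<open>The constructor \<open>topology\<close> is only meaningful on families satisfying \<open>istopology\<close>; this is
  established below for subsets of the spectrum.\<close>

definition zariski :: "('a, 'b) ring_scheme \<Rightarrow> 'a set set \<Rightarrow> 'a set topology" where
  "zariski R Y = topology (\<lambda>U. \<exists>J. ideal J R \<and> U = Y - hull_in Y J)"

definition z_circ_ideal :: "('a, 'b) ring_scheme \<Rightarrow> 'a set \<Rightarrow> bool" where
  "z_circ_ideal R I \<longleftrightarrow> ideal I R \<and>
     (\<forall>b \<in> I. \<forall>a \<in> carrier R.
        hull_in (Min_primes R) {b} \<subseteq> hull_in (Min_primes R) {a} \<longrightarrow> a \<in> I)"

definition sz_circ_ideal :: "('a, 'b) ring_scheme \<Rightarrow> 'a set \<Rightarrow> bool" where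
  "sz_circ_ideal R I \<longleftrightarrow> ideal I R \<and>
     (\<forall>F. finite F \<and> F \<subseteq> I \<longrightarrow> (\<forall>a \<in> carrier R.
        hull_in (Min_primes R) F \<subseteq> hull_in (Min_primes R) {a} \<longrightarrow> a \<in> I))"

lemma hull_in_Int_ideals:
  assumes "cring R" "Y \<subseteq> Spec R" "ideal J R" "ideal K R"
  shows "hull_in Y (J \<inter> K) = hull_in Y J \<union> hull_in Y K"
proof -
  have "J \<subseteq> P \<or> K \<subseteq> P" if P: "P \<in> Y" and sub: "J \<inter> K \<subseteq> P" for P
  proof (rule ccontr)
    assume "\<not> (J \<subseteq> P \<or> K \<subseteq> P)"
    then obtain x y where x: "x \<in> J" "x \<notin> P" and y: "y \<in> K" "y \<notin> P" by blast
    have p: "primeideal P R" using P assms(2) by (auto simp: Spec_def)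
    have c: "x \<in> carrier R" "y \<in> carrier R"
      using ideal.Icarr[OF assms(3) x(1)] ideal.Icarr[OF assms(4) y(1)] by auto
    have "x \<otimes>\<^bsub>R\<^esub> y \<in> J \<inter> K"
      using x y c assms(3,4) by (simp add: ideal.I_l_closed ideal.I_r_closed)
    with sub x y show False using primeideal.I_prime[OF p c] by blast
  qed
  then show ?thesis by (auto simp: hull_in_def)
qed

lemma istopology_zariski:
  assumes R: "cring R" and Y: "Y \<subseteq> Spec R"
  shows "istopology (\<lambda>U. \<exists>J. ideal J R \<and> U = Y - hull_in Y J)"
proof -
  interpret cring R by (fact R)
  show ?thesis
    unfolding istopology_def
  proof (intro conjI allI impI)
    fix U V
    assume "\<exists>J. ideal J R \<and> U = Y - hull_in Y J" "\<exists>J. ideal J R \<and> V = Y - hull_in Y J"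
    then obtain J K where J: "ideal J R" "U = Y - hull_in Y J"
      and K: "ideal K R" "V = Y - hull_in Y K" by blast
    have "ideal (J \<inter> K) R" using J K by (simp add: i_intersect)
    moreover have "U \<inter> V = Y - hull_in Y (J \<inter> K)"
      using hull_in_Int_ideals[OF R Y J(1) K(1)] J K by auto
    ultimately show "\<exists>J. ideal J R \<and> U \<inter> V = Y - hull_in Y J" by blast
  next
    fix \<U>
    assume "\<forall>U \<in> \<U>. \<exists>J. ideal J R \<and> U = Y - hull_in Y J"
    then have "\<exists>f. \<forall>U \<in> \<U>. ideal (f U) R \<and> U = Y - hull_in Y (f U)"
      by (rule bchoice)
    then obtain f where f: "\<And>U. U \<in> \<U> \<Longrightarrow> ideal (f U) R"
      "\<And>U. U \<in> \<U> \<Longrightarrow> U = Y - hull_in Y (f U)"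
      by blast
    define A where "A = (\<Union>U \<in> \<U>. f U)"
    have A: "A \<subseteq> carrier R"
      unfolding A_def using ideal.Icarr[OF f(1)] by blast
    have "hull_in Y (Idl\<^bsub>R\<^esub> A) = hull_in Y A"
    proof -
      have "Idl\<^bsub>R\<^esub> A \<subseteq> P \<longleftrightarrow> A \<subseteq> P" if "P \<in> Y" for P
      proof -
        have "ideal P R" using that Y by (auto simp: Spec_def primeideal_def)
        then show ?thesis using genideal_self[OF A] genideal_minimal by blast
      qed
      then show ?thesis by (auto simp: hull_in_def)
    qed
    moreover have "\<Union> \<U> = Y - hull_in Y A"
    proof -
      have "\<Union> \<U> = (\<Union>U \<in> \<U>. Y - hull_in Y (f U))"
        using SUP_cong[OF refl f(2), of \<U> "\<lambda>U. U"] by simp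
      also have "\<dots> = Y - hull_in Y A" by (auto simp: A_def hull_in_def)
      finally show ?thesis .
    qed
    ultimately show "\<exists>J. ideal J R \<and> \<Union> \<U> = Y - hull_in Y J"
      using genideal_ideal[OF A] by (intro exI[of _ "Idl\<^bsub>R\<^esub> A"]) simp
  qed
qed

lemma openin_zariski:
  assumes "cring R" "Y \<subseteq> Spec R"
  shows "openin (zariski R Y) U \<longleftrightarrow> (\<exists>J. ideal J R \<and> U = Y - hull_in Y J)"
  unfolding zariski_def by (simp add: topology_inverse'[OF istopology_zariski[OF assms]])

lemma topspace_zariski:
  assumes R: "cring R" and Y: "Y \<subseteq> Spec R"
  shows "topspace (zariski R Y) = Y"
proof -
  interpret cring R by (fact R)
  have "Y = Y - hull_in Y (carrier R)"
  proof -
    have "\<not> carrier R \<subseteq> P" if "P \<in> Y" for P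
    proof -
      have p: "primeideal P R" using that Y by (auto simp: Spec_def)
      have "P \<subseteq> carrier R"
        using ideal.Icarr[OF primeideal.axioms(1)[OF p]] by (intro subsetI)
      then show ?thesis using primeideal.I_notcarr[OF p] by blast
    qed
    then show ?thesis by (auto simp: hull_in_def)
  qed
  then have "openin (zariski R Y) Y"
    unfolding openin_zariski[OF R Y] using oneideal by (intro exI conjI)
  moreover have "U \<subseteq> Y" if "openin (zariski R Y) U" for U
    using that unfolding openin_zariski[OF R Y] by blast
  ultimately show ?thesis by (meson openin_subset openin_topspace subset_antisym)
qed

lemma closedin_zariski:
  assumes R: "cring R" and Y: "Y \<subseteq> Spec R"
  shows "closedin (zariski R Y) C \<longleftrightarrow> (\<exists>J. ideal J R \<and> C = hull_in Y J)"
proof -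
  have "C \<subseteq> Y \<and> Y - C = Y - hull_in Y J \<longleftrightarrow> C = hull_in Y J" for J
    by (auto simp: hull_in_def)
  then show ?thesis
    unfolding closedin_def topspace_zariski[OF R Y] openin_zariski[OF R Y]
    by (metis (no_types))
qed

end

theory Submission
  imports Defs "HOL-Algebra.Ring_Divisibility"
begin

text \<open>For finite \<open>F\<close>, both \<open>h\<^sub>m(F) \<subseteq> h\<^sub>m(a)\<close> and \<open>(h\<^sub>Y(F))\<^sup>\<circ> \<subseteq> h\<^sub>Y(a)\<close> say that every \<open>s\<close> with
  \<open>s F \<subseteq> Rad(R)\<close> satisfies \<open>s a \<in> Rad(R)\<close>. On the topological side, the basic open sets are the
  complements of the \<open>h\<^sub>Y(s)\<close>, and such a complement lies in \<open>h\<^sub>Y(F)\<close> precisely when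
  \<open>s F \<subseteq> k(Y) = Rad(R)\<close>. On the side of minimal primes, an element of a minimal prime \<open>P\<close> is
  multiplied into the radical by some element outside \<open>P\<close>; finiteness of \<open>F\<close> allows one to take
  a single multiplier for all of \<open>F\<close>.\<close>

context cring
begin

section \<open>Prime ideals and multiplicative sets\<close>

lemma primeideal_mult_iff:
  assumes "primeideal P R" "x \<in> carrier R" "y \<in> carrier R"
  shows "x \<otimes> y \<in> P \<longleftrightarrow> x \<in> P \<or> y \<in> P"
proof -
  interpret P: primeideal P R by fact
  show ?thesis
    using assms(2,3) P.I_prime P.I_l_closed P.I_r_closed by blast
qed

lemma one_notin_primeideal:
  assumes "primeideal P R"
  shows "\<one> \<notin> P"
  using ideal.one_imp_carrier[OF primeideal.axioms(1)[OF assms]] primeideal.I_notcarr[OF assms]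
  by auto

text \<open>Krull's argument: an ideal maximal among those disjoint from a multiplicative set is
  prime. Zorn's lemma supplies one, the zero ideal making the family nonempty.\<close>

lemma exists_primeideal_disjoint:
  assumes M: "M \<subseteq> carrier R" and one: "\<one> \<in> M" and zero: "\<zero> \<notin> M"
    and mult: "\<And>x y. \<lbrakk>x \<in> M; y \<in> M\<rbrakk> \<Longrightarrow> x \<otimes> y \<in> M"
  obtains P where "primeideal P R" "P \<inter> M = {}"
proof -
  let ?A = "{I. ideal I R \<and> I \<inter> M = {}}"
  have "\<exists>Q\<in>?A. \<forall>X\<in>?A. Q \<subseteq> X \<longrightarrow> X = Q"
  proof (rule subset_Zorn_nonempty)
    show "?A \<noteq> {}" using zeroideal zero by blast
  next
    fix C assume ne: "C \<noteq> {}" and C: "subset.chain ?A C"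
    have "subset.chain {I. ideal I R} C"
      using C by (auto simp: subset_chain_def)
    then have "ideal (\<Union>C) R"
      using chain_Union_is_ideal[of C] ne by simp
    moreover have "\<Union>C \<inter> M = {}"
      using C by (auto simp: subset_chain_def)
    ultimately show "\<Union>C \<in> ?A" by blast
  qed
  then obtain Q where "Q \<in> ?A" and maximal: "\<forall>X\<in>?A. Q \<subseteq> X \<longrightarrow> X = Q" ..
  then have Q: "ideal Q R" "Q \<inter> M = {}" by auto
  have max: "X = Q" if "ideal X R" "X \<inter> M = {}" "Q \<subseteq> X" for X
    using maximal that by simp
  interpret Q: ideal Q R by fact
  \<comment> \<open>For \<open>a\<close> outside \<open>Q\<close>, the ideal
    \<open>Q <+> PIdl a\<close> is strictly larger than \<open>Q\<close>, so maximality forces it to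
    meet \<open>M\<close>.\<close>
  have meets: "\<exists>q\<in>Q. \<exists>x\<in>carrier R. q \<oplus> x \<otimes> a \<in> M"
    if a: "a \<in> carrier R" "a \<notin> Q" for a
  proof (rule ccontr)
    assume none: "\<not> ?thesis"
    have sum: "Q <+> PIdl a = {q \<oplus> x \<otimes> a | q x. q \<in> Q \<and> x \<in> carrier R}"
      by (auto simp: set_add_def' cgenideal_def)
    have "ideal (Q <+> PIdl a) R"
      using a Q(1) by (simp add: add_ideals cgenideal_ideal)
    moreover have "(Q <+> PIdl a) \<inter> M = {}" using none by (auto simp: sum)
    moreover have "Q \<subseteq> Q <+> PIdl a"
    proof
      fix q assume q: "q \<in> Q"
      then have "q = q \<oplus> \<zero> \<otimes> a" using a by (simp add: Q.Icarr)
      then show "q \<in> Q <+> PIdl a" unfolding sum using q zero_closed by blast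
    qed
    ultimately have "Q <+> PIdl a = Q" by (rule max)
    moreover have "a = \<zero> \<oplus> \<one> \<otimes> a" using a by simp
    then have "a \<in> Q <+> PIdl a" unfolding sum using Q.zero_closed one_closed by blast
    ultimately show False using a by blast
  qed
  have "primeideal Q R"
  proof (rule primeidealI[OF Q(1) is_cring])
    show "carrier R \<noteq> Q" using one Q(2) by blast
  next
    fix a b assume ab: "a \<in> carrier R" "b \<in> carrier R" "a \<otimes> b \<in> Q"
    show "a \<in> Q \<or> b \<in> Q"
    proof (rule ccontr)
      assume neg: "\<not> (a \<in> Q \<or> b \<in> Q)"
      obtain p x where p: "p \<in> Q" "x \<in> carrier R" "p \<oplus> x \<otimes> a \<in> M"
        using meets ab neg by meson
      obtain q y where q: "q \<in> Q" "y \<in> carrier R" "q \<oplus> y \<otimes> b \<in> M"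
        using meets ab neg by meson
      have c: "p \<in> carrier R" "q \<in> carrier R" using p q by (auto simp: Q.Icarr)
      \<comment> \<open>Expanding the product of two elements of \<open>M\<close>, every term has a
        factor \<open>p\<close>, \<open>q\<close> or \<open>a \<otimes> b\<close>, all in
        \<open>Q\<close>; this contradicts disjointness from \<open>M\<close>.\<close>
      have "(p \<oplus> x \<otimes> a) \<otimes> (q \<oplus> y \<otimes> b)
          = (p \<otimes> (q \<oplus> y \<otimes> b) \<oplus> (x \<otimes> a) \<otimes> q) \<oplus> (x \<otimes> y) \<otimes> (a \<otimes> b)"
        using c p(2) q(2) ab(1,2) by algebra
      also have "\<dots> \<in> Q"
        using c p(1,2) q(1,2) ab by (simp add: Q.I_l_closed Q.I_r_closed)
      finally show False using mult[OF p(3) q(3)] Q(2) by blast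
    qed
  qed
  with Q(2) show thesis by (rule that[rotated -1])
qed

section \<open>Minimal primes and the radical\<close>

lemma Min_primes_subset_Spec: "Min_primes R \<subseteq> Spec R"
  by (auto simp: Min_primes_def)

text \<open>Zorn's lemma for reverse inclusion: the intersection of a nonempty chain of primes is
  again prime.\<close>

lemma exists_Min_primes_subset:
  assumes P: "P \<in> Spec R"
  obtains Q where "Q \<in> Min_primes R" "Q \<subseteq> P"
proof -
  let ?D = "{Q. primeideal Q R \<and> Q \<subseteq> P}"
  \<comment> \<open>Zorn's lemma is applied here in its form for maximal sets, so primes are
    replaced by their complements in the carrier.\<close>
  let ?A = "(\<lambda>Q. carrier R - Q) ` ?D"
  have sub: "Q \<subseteq> carrier R" if "primeideal Q R" for Q
    using ideal.Icarr[OF primeideal.axioms(1)[OF that]] by blast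
  have "\<exists>M\<in>?A. \<forall>X\<in>?A. M \<subseteq> X \<longrightarrow> X = M"
  proof (rule subset_Zorn_nonempty)
    show "?A \<noteq> {}" using P by (auto simp: Spec_def)
  next
    fix C assume ne: "C \<noteq> {}" and C: "subset.chain ?A C"
    define E where "E = {Q \<in> ?D. carrier R - Q \<in> C}"
    have CE: "C = (\<lambda>Q. carrier R - Q) ` E"
      using C by (auto simp: E_def subset_chain_def)
    have E: "primeideal Q R" "Q \<subseteq> P" if "Q \<in> E" for Q
      using that by (auto simp: E_def)
    have chain: "Q \<subseteq> Q' \<or> Q' \<subseteq> Q" if "Q \<in> E" "Q' \<in> E" for Q Q'
    proof -
      have "carrier R - Q \<subseteq> carrier R - Q' \<or> carrier R - Q' \<subseteq> carrier R - Q"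
        using C that by (auto simp: E_def subset_chain_def)
      then show ?thesis using sub E(1) that by blast
    qed
    from ne CE obtain Q0 where Q0: "Q0 \<in> E" by blast
    have "primeideal (\<Inter>E) R"
    proof (rule primeidealI[OF _ is_cring])
      show "ideal (\<Inter>E) R"
        using Q0 E(1) primeideal.axioms(1) by (intro i_Intersect) blast+
      show "carrier R \<noteq> \<Inter>E"
        using one_notin_primeideal[OF E(1)[OF Q0]] Q0 one_closed by blast
    next
      fix a b assume ab: "a \<in> carrier R" "b \<in> carrier R" "a \<otimes> b \<in> \<Inter>E"
      show "a \<in> \<Inter>E \<or> b \<in> \<Inter>E"
      proof (rule ccontr)
        assume "\<not> ?thesis"
        then obtain Q Q' where Q: "Q \<in> E" "a \<notin> Q" "Q' \<in> E" "b \<notin> Q'" by blast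
        \<comment> \<open>The smaller of \<open>Q\<close> and \<open>Q'\<close> omits both
          \<open>a\<close> and \<open>b\<close>, yet it contains their product.\<close>
        with chain[of Q Q'] obtain Q'' where "Q'' \<in> E" "a \<notin> Q''" "b \<notin> Q''" by blast
        then show False using ab E(1) primeideal_mult_iff by blast
      qed
    qed
    moreover have "\<Inter>E \<subseteq> P" using Q0 E(2) by blast
    moreover have "\<Union>C = carrier R - \<Inter>E" using CE by blast
    ultimately show "\<Union>C \<in> ?A" by blast
  qed
  then obtain N where "N \<in> ?A" and maximal: "\<forall>X\<in>?A. N \<subseteq> X \<longrightarrow> X = N" ..
  then obtain Q where Q: "primeideal Q R" "Q \<subseteq> P" and N: "N = carrier R - Q" by auto
  have max: "carrier R - Q' = carrier R - Q"
    if "primeideal Q' R" "Q' \<subseteq> P" "carrier R - Q \<subseteq> carrier R - Q'" for Q'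
    using maximal that unfolding N by simp
  have "Q' = Q" if Q': "primeideal Q' R" "Q' \<subseteq> Q" for Q'
  proof -
    have "carrier R - Q' = carrier R - Q" using Q Q' by (intro max) blast+
    then show ?thesis using sub[OF Q(1)] sub[OF Q'(1)] by blast
  qed
  with Q show thesis by (intro that[of Q]) (auto simp: Min_primes_def Spec_def)
qed

lemma Rad_iff: "x \<in> Rad R \<longleftrightarrow> x \<in> carrier R \<and> (\<forall>P\<in>Spec R. x \<in> P)"
  by (auto simp: Rad_def ker_of_def)

text \<open>Every prime contains a minimal one, so membership in the radical can be tested on
  minimal primes alone.\<close>

lemma Rad_iff_Min_primes: "x \<in> Rad R \<longleftrightarrow> x \<in> carrier R \<and> (\<forall>P\<in>Min_primes R. x \<in> P)"
  unfolding Rad_iff by (meson Min_primes_subset_Spec exists_Min_primes_subset subsetD)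

text \<open>Otherwise the products \<open>s f\<^sup>n\<close> with \<open>s \<notin> P\<close> form a multiplicative set avoiding \<open>0\<close>,
  and a prime disjoint from it is strictly smaller than \<open>P\<close>.\<close>

lemma Min_primes_mult_Rad:
  assumes P: "P \<in> Min_primes R" and f: "f \<in> P"
  obtains s where "s \<in> carrier R" "s \<notin> P" "s \<otimes> f \<in> Rad R"
proof -
  have prime: "primeideal P R" using P by (auto simp: Min_primes_def Spec_def)
  interpret P: primeideal P R by fact
  have fc: "f \<in> carrier R" using f by (rule P.Icarr)
  define M where "M = {s \<otimes> f [^] n | s (n::nat). s \<in> carrier R \<and> s \<notin> P}"
  have outM: "s \<otimes> f [^] n \<in> M" if "s \<in> carrier R" "s \<notin> P" for s and n :: nat
    using that unfolding M_def by blast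
  have "\<zero> \<in> M"
  proof (rule ccontr)
    assume zero: "\<zero> \<notin> M"
    have M: "M \<subseteq> carrier R" using fc by (auto simp: M_def)
    have one: "\<one> \<in> M"
      using outM[of \<one> 0] one_notin_primeideal[OF prime] by simp
    have mult: "x \<otimes> y \<in> M" if xy: "x \<in> M" "y \<in> M" for x y
    proof -
      obtain s t and m n :: nat where st: "s \<in> carrier R" "s \<notin> P" "t \<in> carrier R" "t \<notin> P"
        and eq: "x = s \<otimes> f [^] m" "y = t \<otimes> f [^] n"
        using xy unfolding M_def by blast
      have "x \<otimes> y = (s \<otimes> t) \<otimes> f [^] (m + n)"
        unfolding eq using st fc by (simp add: nat_pow_mult[symmetric] m_ac)
      then show ?thesis
        using outM[of "s \<otimes> t"] st primeideal_mult_iff[OF prime] by simp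
    qed
    obtain Q where Q: "primeideal Q R" "Q \<inter> M = {}"
      using exists_primeideal_disjoint[OF M one zero mult] .
    interpret Q: primeideal Q R by fact
    \<comment> \<open>Exponent 0 puts all ring elements outside \<open>P\<close> into
      \<open>M\<close>, which \<open>Q\<close> avoids.\<close>
    have "Q \<subseteq> P"
    proof
      fix q assume q: "q \<in> Q"
      show "q \<in> P"
      proof (rule ccontr)
        assume "q \<notin> P"
        then have "q \<in> M" using outM[of q 0] q by (simp add: Q.Icarr)
        with q Q(2) show False by blast
      qed
    qed
    then have "Q = P" using P Q(1) by (auto simp: Min_primes_def Spec_def)
    moreover have "f \<in> M"
      using outM[of \<one> 1] one_notin_primeideal[OF prime] fc by simp
    ultimately show False using f Q(2) by blast
  qed
  then obtain s and n :: nat where s: "s \<in> carrier R" "s \<notin> P" and z: "s \<otimes> f [^] n = \<zero>"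
    unfolding M_def by force
  \<comment> \<open>Every prime contains \<open>s \<otimes> f [^] n = \<zero>\<close>; primality
    strips off the factors \<open>f\<close> one at a time.\<close>
  have "s \<otimes> f \<in> Q" if Q: "primeideal Q R" for Q
  proof -
    interpret Q: primeideal Q R by fact
    have "s \<otimes> f [^] k \<in> Q \<Longrightarrow> s \<otimes> f \<in> Q" for k :: nat
    proof (induction k)
      case 0
      then show ?case using s fc by (simp add: Q.I_r_closed)
    next
      case (Suc k)
      then show ?case using s fc by (auto simp: primeideal_mult_iff[OF Q])
    qed
    then show ?thesis using z Q.zero_closed by metis
  qed
  then show thesis using that s fc by (simp add: Rad_iff Spec_def)
qed

lemma Rad_l_closed:
  assumes "x \<in> carrier R" "y \<in> Rad R"
  shows "x \<otimes> y \<in> Rad R"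
  using assms by (auto simp: Rad_iff Spec_def primeideal_mult_iff)

text \<open>The product of the multipliers for the single elements serves all of \<open>F\<close>:
  it stays outside \<open>P\<close> by primality, and the radical absorbs the extra factors.\<close>

lemma Min_primes_mult_Rad_finite:
  assumes P: "P \<in> Min_primes R" and F: "finite F" "F \<subseteq> P"
  shows "\<exists>s\<in>carrier R. s \<notin> P \<and> (\<forall>f\<in>F. s \<otimes> f \<in> Rad R)"
  using F
proof (induction F)
  case empty
  then show ?case using P one_notin_primeideal by (auto simp: Min_primes_def Spec_def)
next
  case (insert f F)
  have prime: "primeideal P R" using P by (auto simp: Min_primes_def Spec_def)
  have car: "P \<subseteq> carrier R"
    using ideal.Icarr[OF primeideal.axioms(1)[OF prime]] by blast
  obtain s where s: "s \<in> carrier R" "s \<notin> P" "\<forall>g\<in>F. s \<otimes> g \<in> Rad R"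
    using insert.IH insert.prems by blast
  obtain t where t: "t \<in> carrier R" "t \<notin> P" "t \<otimes> f \<in> Rad R"
    using Min_primes_mult_Rad[OF P] insert.prems by blast
  have "(t \<otimes> s) \<otimes> g \<in> Rad R" if g: "g \<in> insert f F" for g
  proof (cases "g = f")
    case True
    have "f \<in> carrier R" using insert.prems car by blast
    then have "(t \<otimes> s) \<otimes> f = s \<otimes> (t \<otimes> f)" using s t by (simp add: m_ac)
    then show ?thesis using True s t by (simp add: Rad_l_closed)
  next
    case False
    then have "g \<in> carrier R" "s \<otimes> g \<in> Rad R" using g insert.prems car s by auto
    then show ?thesis using s t by (simp add: m_assoc Rad_l_closed)
  qed
  moreover have "t \<otimes> s \<notin> P" using s t primeideal_mult_iff[OF prime] by blast
  ultimately show ?case using s t by blast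
qed

section \<open>Hull inclusions as annihilator conditions modulo the radical\<close>

text \<open>If \<open>s\<close> carries \<open>F\<close> into the radical, each minimal prime
  contains \<open>s\<close> or all of \<open>F\<close>. Conversely, at a minimal prime containing
  \<open>F\<close> there is such an \<open>s\<close> outside it, and \<open>s \<otimes> a\<close> in
  that prime then forces \<open>a\<close> in.\<close>

lemma hull_Min_primes_subset_iff:
  assumes F: "finite F" "F \<subseteq> carrier R" and a: "a \<in> carrier R"
  shows "hull_in (Min_primes R) F \<subseteq> hull_in (Min_primes R) {a} \<longleftrightarrow>
    (\<forall>s\<in>carrier R. (\<forall>f\<in>F. s \<otimes> f \<in> Rad R) \<longrightarrow> s \<otimes> a \<in> Rad R)"
proof
  assume sub: "hull_in (Min_primes R) F \<subseteq> hull_in (Min_primes R) {a}"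
  have "s \<otimes> a \<in> P"
    if s: "s \<in> carrier R" "\<forall>f\<in>F. s \<otimes> f \<in> Rad R" and P: "P \<in> Min_primes R" for s P
  proof -
    have prime: "primeideal P R" using P by (auto simp: Min_primes_def Spec_def)
    have "s \<in> P \<or> F \<subseteq> P"
      using s P F primeideal_mult_iff[OF prime] unfolding Rad_iff_Min_primes by blast
    then have "s \<in> P \<or> a \<in> P" using sub P by (auto simp: hull_in_def)
    then show ?thesis using s a primeideal_mult_iff[OF prime] by blast
  qed
  then show "\<forall>s\<in>carrier R. (\<forall>f\<in>F. s \<otimes> f \<in> Rad R) \<longrightarrow> s \<otimes> a \<in> Rad R"
    using a by (simp add: Rad_iff_Min_primes)
next
  assume ann: "\<forall>s\<in>carrier R. (\<forall>f\<in>F. s \<otimes> f \<in> Rad R) \<longrightarrow> s \<otimes> a \<in> Rad R"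
  have "a \<in> P" if P: "P \<in> Min_primes R" "F \<subseteq> P" for P
  proof -
    have prime: "primeideal P R" using P by (auto simp: Min_primes_def Spec_def)
    obtain s where s: "s \<in> carrier R" "s \<notin> P" "\<forall>f\<in>F. s \<otimes> f \<in> Rad R"
      using Min_primes_mult_Rad_finite[OF P(1) F(1) P(2)] by blast
    then have "s \<otimes> a \<in> P" using ann P(1) by (auto simp: Rad_iff_Min_primes)
    then show ?thesis using s a primeideal_mult_iff[OF prime] by blast
  qed
  then show "hull_in (Min_primes R) F \<subseteq> hull_in (Min_primes R) {a}"
    by (auto simp: hull_in_def)
qed

text \<open>The right-hand side is that of \<open>hull_Min_primes_subset_iff\<close>;
  \<open>Y\<close> disappears from it because its kernel is the radical.\<close>

lemma interior_hull_subset_iff: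
  assumes Y: "Y \<subseteq> Spec R" and ker: "ker_of R Y = Rad R"
    and F: "F \<subseteq> carrier R" and a: "a \<in> carrier R"
  shows "zariski R Y interior_of (hull_in Y F) \<subseteq> hull_in Y {a} \<longleftrightarrow>
    (\<forall>s\<in>carrier R. (\<forall>f\<in>F. s \<otimes> f \<in> Rad R) \<longrightarrow> s \<otimes> a \<in> Rad R)"
proof
  assume sub: "zariski R Y interior_of (hull_in Y F) \<subseteq> hull_in Y {a}"
  show "\<forall>s\<in>carrier R. (\<forall>f\<in>F. s \<otimes> f \<in> Rad R) \<longrightarrow> s \<otimes> a \<in> Rad R"
  proof (intro ballI impI)
    fix s assume s: "s \<in> carrier R" "\<forall>f\<in>F. s \<otimes> f \<in> Rad R"
    \<comment> \<open>The basic open set of primes in \<open>Y\<close> omitting \<open>s\<close>,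
      written with a principal ideal because \<open>zariski\<close> is defined by ideals.\<close>
    let ?U = "Y - hull_in Y (PIdl s)"
    have U: "P \<in> ?U \<longleftrightarrow> P \<in> Y \<and> s \<notin> P" for P
    proof -
      have "PIdl s \<subseteq> P \<longleftrightarrow> s \<in> P" if "P \<in> Y"
      proof -
        have "ideal P R" using that Y primeideal.axioms(1) by (auto simp: Spec_def)
        then show ?thesis using cgenideal_minimal cgenideal_self[OF s(1)] by blast
      qed
      then show ?thesis by (auto simp: hull_in_def)
    qed
    have "openin (zariski R Y) ?U"
      using openin_zariski[OF is_cring Y] cgenideal_ideal[OF s(1)] by blast
    moreover have "?U \<subseteq> hull_in Y F"
    proof
      fix P assume "P \<in> ?U"
      then have P: "P \<in> Y" "s \<notin> P" using U by auto
      then have prime: "primeideal P R" using Y by (auto simp: Spec_def)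
      have "f \<in> P" if f: "f \<in> F" for f
      proof -
        have "s \<otimes> f \<in> P" using s f P Y by (auto simp: Rad_iff)
        then show ?thesis using s f P F primeideal_mult_iff[OF prime] by blast
      qed
      with P show "P \<in> hull_in Y F" by (auto simp: hull_in_def)
    qed
    ultimately have "?U \<subseteq> hull_in Y {a}" using sub interior_of_maximal by blast
    then have "s \<in> P \<or> a \<in> P" if "P \<in> Y" for P
      using that U[of P] unfolding hull_in_def by blast
    then have "s \<otimes> a \<in> P" if "P \<in> Y" for P
      using that s a Y primeideal_mult_iff[of P s a] by (auto simp: Spec_def)
    then have "s \<otimes> a \<in> ker_of R Y" using s a by (auto simp: ker_of_def)
    then show "s \<otimes> a \<in> Rad R" by (simp add: ker)
  qed
next
  assume ann: "\<forall>s\<in>carrier R. (\<forall>f\<in>F. s \<otimes> f \<in> Rad R) \<longrightarrow> s \<otimes> a \<in> Rad R"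
  show "zariski R Y interior_of (hull_in Y F) \<subseteq> hull_in Y {a}"
  proof
    fix P assume "P \<in> zariski R Y interior_of (hull_in Y F)"
    then obtain J where J: "ideal J R" "P \<in> Y - hull_in Y J" "Y - hull_in Y J \<subseteq> hull_in Y F"
      unfolding interior_of_def openin_zariski[OF is_cring Y] by blast
    \<comment> \<open>A prime of \<open>Y\<close> omitting this \<open>s\<close> does not contain
      \<open>J\<close>, so it lies in the open set and hence in the hull of \<open>F\<close>. Thus
      each prime of \<open>Y\<close> contains \<open>s\<close> or all of \<open>F\<close>.\<close>
    then obtain s where s: "s \<in> J" "s \<notin> P" and P: "P \<in> Y"
      by (auto simp: hull_in_def)
    have sc: "s \<in> carrier R" using ideal.Icarr[OF J(1) s(1)] .
    have prime: "primeideal Q R" if "Q \<in> Y" for Q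
      using that Y by (auto simp: Spec_def)
    have "s \<otimes> f \<in> Rad R" if f: "f \<in> F" for f
    proof -
      have "s \<in> Q \<or> f \<in> Q" if "Q \<in> Y" for Q
        using that J(3) s f by (auto simp: hull_in_def)
      then have "s \<otimes> f \<in> Q" if "Q \<in> Y" for Q
        using that sc f F primeideal_mult_iff[OF prime] by blast
      then have "s \<otimes> f \<in> ker_of R Y" using sc f F by (auto simp: ker_of_def)
      then show ?thesis by (simp add: ker)
    qed
    then have "s \<otimes> a \<in> P" using ann sc P Y by (auto simp: Rad_iff)
    then have "a \<in> P" using sc a s primeideal_mult_iff[OF prime[OF P]] by blast
    with P show "P \<in> hull_in Y {a}" by (auto simp: hull_in_def)
  qed
qed

lemma interior_hull_subset_iff_Min_primes:
  assumes "Y \<subseteq> Spec R" "ker_of R Y = Rad R" "finite F" "F \<subseteq> carrier R" "a \<in> carrier R"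
  shows "zariski R Y interior_of (hull_in Y F) \<subseteq> hull_in Y {a} \<longleftrightarrow>
    hull_in (Min_primes R) F \<subseteq> hull_in (Min_primes R) {a}"
  unfolding interior_hull_subset_iff[OF assms(1,2,4,5)] hull_Min_primes_subset_iff[OF assms(3-5)]
  by (rule refl)

end

section \<open>From single elements to subsets, and the equivalences\<close>

text \<open>Within \<open>Y\<close>, the hull of \<open>S\<close> is the intersection of the hulls
  of its elements, so the inclusion is checked elementwise. This reduces (iii) to (ii) in both
  halves of the theorem.\<close>

lemma hull_in_set_condition_iff:
  assumes "A \<subseteq> Y"
  shows "(\<forall>S. S \<subseteq> C \<longrightarrow> A \<subseteq> hull_in Y S \<longrightarrow> S \<subseteq> I) \<longleftrightarrow>
    (\<forall>a\<in>C. A \<subseteq> hull_in Y {a} \<longrightarrow> a \<in> I)"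
proof -
  have eq: "A \<subseteq> hull_in Y S \<longleftrightarrow> (\<forall>a\<in>S. \<forall>P\<in>A. a \<in> P)" for S
    using assms by (auto simp: hull_in_def)
  show ?thesis
    unfolding eq
  proof (intro iffI allI ballI impI)
    fix a
    assume "\<forall>S. S \<subseteq> C \<longrightarrow> (\<forall>a\<in>S. \<forall>P\<in>A. a \<in> P) \<longrightarrow> S \<subseteq> I" "a \<in> C" "\<forall>b\<in>{a}. \<forall>P\<in>A. b \<in> P"
    then show "a \<in> I" by (auto dest: spec[where x = "{a}"])
  qed auto
qed

theorem proposition3p10:
  fixes R :: "('a, 'b) ring_scheme" and Y :: "'a set set" and I :: "'a set"
  assumes "cring R"
    and "Y \<subseteq> Spec R"
    and "ker_of R Y = Rad R"
    and "ideal I R"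
  shows
    "((z_circ_ideal R I \<longleftrightarrow>
         (\<forall>b \<in> I. \<forall>a \<in> carrier R.
            zariski R Y interior_of (hull_in Y {b}) \<subseteq> hull_in Y {a} \<longrightarrow> a \<in> I)) \<and>
      (z_circ_ideal R I \<longleftrightarrow>
         (\<forall>b \<in> I. \<forall>S. S \<subseteq> carrier R \<longrightarrow>
            zariski R Y interior_of (hull_in Y {b}) \<subseteq> hull_in Y S \<longrightarrow> S \<subseteq> I))) \<and>
     ((sz_circ_ideal R I \<longleftrightarrow>
         (\<forall>F. finite F \<and> F \<subseteq> I \<longrightarrow> (\<forall>a \<in> carrier R.
            zariski R Y interior_of (hull_in Y F) \<subseteq> hull_in Y {a} \<longrightarrow> a \<in> I))) \<and>
      (sz_circ_ideal R I \<longleftrightarrow>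
         (\<forall>F. finite F \<and> F \<subseteq> I \<longrightarrow> (\<forall>S. S \<subseteq> carrier R \<longrightarrow>
            zariski R Y interior_of (hull_in Y F) \<subseteq> hull_in Y S \<longrightarrow> S \<subseteq> I))))"
proof -
  interpret cring R by fact
  interpret I: ideal I R by fact
  let ?int = "\<lambda>F. zariski R Y interior_of (hull_in Y F)"
  have car: "I \<subseteq> carrier R" using I.Icarr by blast
  have int_sub: "?int F \<subseteq> Y" for F
    using interior_of_subset[of "zariski R Y" "hull_in Y F"] by (auto simp: hull_in_def)
  note set_iff = hull_in_set_condition_iff[OF int_sub]
  have iff: "?int F \<subseteq> hull_in Y {a} \<longleftrightarrow>
      hull_in (Min_primes R) F \<subseteq> hull_in (Min_primes R) {a}"
    if "finite F" "F \<subseteq> I" "a \<in> carrier R" for F a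
    using that car assms(2,3) by (intro interior_hull_subset_iff_Min_primes) auto
  \<comment> \<open>The condition on one element \<open>b\<close> is the case of the finite set
    \<open>{b}\<close> in \<open>iff\<close>.\<close>
  have z: "z_circ_ideal R I \<longleftrightarrow>
      (\<forall>b \<in> I. \<forall>a \<in> carrier R. ?int {b} \<subseteq> hull_in Y {a} \<longrightarrow> a \<in> I)"
    using assms(4) iff by (simp add: z_circ_ideal_def)
  have sz: "sz_circ_ideal R I \<longleftrightarrow>
      (\<forall>F. finite F \<and> F \<subseteq> I \<longrightarrow> (\<forall>a \<in> carrier R. ?int F \<subseteq> hull_in Y {a} \<longrightarrow> a \<in> I))"
    using assms(4) iff by (simp add: sz_circ_ideal_def)
  show ?thesis
    unfolding set_iff using z sz by blast
qed

end
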